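(* Let $\mathcal{A}$ be an abelian category and $N\in\mathbb{N}$. Then $\mathrm{C}_\infty(\mathcal{A})$ and $\mathrm{C}_N(\mathcal{A})$ are abelian as well.
   Context: An $\infty$-complex in $\mathcal{A}$ is a $\mathbb{Z}$-indexed diagram $\cdots\to X^{n-1}\xrightarrow{d_X}X^n\xrightarrow{d_X}X^{n+1}\to\cdots$ in $\mathcal{A}$ with no condition on $d_X$; a morphism is a family $g^i:X^i\to Y^i$ ($i\in\mathbb{Z}$) commuting with the differentials. These form $\mathrm{C}_\infty(\mathcal{A})$. $\mathrm{C}_N(\mathcal{A})$ is the full subcategory of those $X$ with $d_X^N=0$. *)

theory Defs
  imports "HOL-Algebra.Group"
begin

text \<open>
  Hom-sets are indexed by source and target and need not be disjoint, so identities, composition and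
  the additive structure carry the objects as arguments.  \<open>Comp C x y z g f\<close> is the composite
  \<open>g \<circ> f\<close> of \<open>f : x \<rightarrow> y\<close> and \<open>g : y \<rightarrow> z\<close>.  The values of the operations
  outside the objects and hom-sets are irrelevant.
\<close>

record ('o, 'm) cat =
  Obj :: "'o set"
  Hom :: "'o \<Rightarrow> 'o \<Rightarrow> 'm set"
  Id :: "'o \<Rightarrow> 'm"
  Comp :: "'o \<Rightarrow> 'o \<Rightarrow> 'o \<Rightarrow> 'm \<Rightarrow> 'm \<Rightarrow> 'm"

record ('o, 'm) ab_cat = "('o, 'm) cat" +
  Zero :: "'o \<Rightarrow> 'o \<Rightarrow> 'm"
  Add :: "'o \<Rightarrow> 'o \<Rightarrow> 'm \<Rightarrow> 'm \<Rightarrow> 'm"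

locale category =
  fixes C :: "('o, 'm, 'r) cat_scheme"
  assumes Id_in_Hom: "x \<in> Obj C \<Longrightarrow> Id C x \<in> Hom C x x"
    and Comp_in_Hom:
      "\<lbrakk>x \<in> Obj C; y \<in> Obj C; z \<in> Obj C; f \<in> Hom C x y; g \<in> Hom C y z\<rbrakk>
        \<Longrightarrow> Comp C x y z g f \<in> Hom C x z"
    and Id_left: "\<lbrakk>x \<in> Obj C; y \<in> Obj C; f \<in> Hom C x y\<rbrakk> \<Longrightarrow> Comp C x y y (Id C y) f = f"
    and Id_right: "\<lbrakk>x \<in> Obj C; y \<in> Obj C; f \<in> Hom C x y\<rbrakk> \<Longrightarrow> Comp C x x y f (Id C x) = f"
    and Comp_assoc:
      "\<lbrakk>w \<in> Obj C; x \<in> Obj C; y \<in> Obj C; z \<in> Obj C;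
        f \<in> Hom C w x; g \<in> Hom C x y; h \<in> Hom C y z\<rbrakk>
        \<Longrightarrow> Comp C w x z (Comp C x y z h g) f = Comp C w y z h (Comp C w x y g f)"

definition full_subcategory :: "('o, 'm, 'r) cat_scheme \<Rightarrow> ('o \<Rightarrow> bool) \<Rightarrow> ('o, 'm, 'r) cat_scheme"
  where "full_subcategory C P = C\<lparr>Obj := {x \<in> Obj C. P x}\<rparr>"

definition monic :: "('o, 'm, 'r) cat_scheme \<Rightarrow> 'o \<Rightarrow> 'o \<Rightarrow> 'm \<Rightarrow> bool" where
  "monic C x y f \<longleftrightarrow> f \<in> Hom C x y \<and>
    (\<forall>w \<in> Obj C. \<forall>g \<in> Hom C w x. \<forall>h \<in> Hom C w x.
      Comp C w x y f g = Comp C w x y f h \<longrightarrow> g = h)"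

definition epic :: "('o, 'm, 'r) cat_scheme \<Rightarrow> 'o \<Rightarrow> 'o \<Rightarrow> 'm \<Rightarrow> bool" where
  "epic C x y f \<longleftrightarrow> f \<in> Hom C x y \<and>
    (\<forall>z \<in> Obj C. \<forall>g \<in> Hom C y z. \<forall>h \<in> Hom C y z.
      Comp C x y z g f = Comp C x y z h f \<longrightarrow> g = h)"

definition zero_object :: "('o, 'm, 'r) cat_scheme \<Rightarrow> 'o \<Rightarrow> bool" where
  "zero_object C z \<longleftrightarrow> z \<in> Obj C \<and>
    (\<forall>x \<in> Obj C. (\<exists>!f. f \<in> Hom C x z) \<and> (\<exists>!f. f \<in> Hom C z x))"

text \<open>The multiplicative notation of \<^locale>\<open>comm_group\<close> stands for the addition of morphisms.\<close>

definition hom_group :: "('o, 'm, 'r) ab_cat_scheme \<Rightarrow> 'o \<Rightarrow> 'o \<Rightarrow> 'm monoid" where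
  "hom_group C x y = \<lparr>carrier = Hom C x y, mult = Add C x y, one = Zero C x y\<rparr>"

locale preadditive_category = category C
  for C :: "('o, 'm, 'r) ab_cat_scheme" +
  assumes hom_comm_group: "\<lbrakk>x \<in> Obj C; y \<in> Obj C\<rbrakk> \<Longrightarrow> comm_group (hom_group C x y)"
    and Comp_Add_left:
      "\<lbrakk>x \<in> Obj C; y \<in> Obj C; z \<in> Obj C; f \<in> Hom C x y; g \<in> Hom C y z; g' \<in> Hom C y z\<rbrakk>
        \<Longrightarrow> Comp C x y z (Add C y z g g') f = Add C x z (Comp C x y z g f) (Comp C x y z g' f)"
    and Comp_Add_right:
      "\<lbrakk>x \<in> Obj C; y \<in> Obj C; z \<in> Obj C; f \<in> Hom C x y; f' \<in> Hom C x y; g \<in> Hom C y z\<rbrakk>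
        \<Longrightarrow> Comp C x y z g (Add C x y f f') = Add C x z (Comp C x y z g f) (Comp C x y z g f')"

definition biproduct ::
    "('o, 'm, 'r) ab_cat_scheme \<Rightarrow> 'o \<Rightarrow> 'o \<Rightarrow> 'o \<Rightarrow> 'm \<Rightarrow> 'm \<Rightarrow> 'm \<Rightarrow> 'm \<Rightarrow> bool" where
  "biproduct C x y b i j p q \<longleftrightarrow> b \<in> Obj C \<and>
    i \<in> Hom C x b \<and> j \<in> Hom C y b \<and> p \<in> Hom C b x \<and> q \<in> Hom C b y \<and>
    Comp C x b x p i = Id C x \<and> Comp C y b y q j = Id C y \<and>
    Add C b b (Comp C b x b i p) (Comp C b y b j q) = Id C b"

text \<open>\<open>is_kernel C x y f k m\<close>: the morphism \<open>m : k \<rightarrow> x\<close> is a kernel of \<open>f : x \<rightarrow> y\<close>.\<close>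

definition is_kernel :: "('o, 'm, 'r) ab_cat_scheme \<Rightarrow> 'o \<Rightarrow> 'o \<Rightarrow> 'm \<Rightarrow> 'o \<Rightarrow> 'm \<Rightarrow> bool" where
  "is_kernel C x y f k m \<longleftrightarrow> k \<in> Obj C \<and> m \<in> Hom C k x \<and>
    Comp C k x y f m = Zero C k y \<and>
    (\<forall>w \<in> Obj C. \<forall>g \<in> Hom C w x. Comp C w x y f g = Zero C w y \<longrightarrow>
      (\<exists>!u. u \<in> Hom C w k \<and> Comp C w k x m u = g))"

text \<open>\<open>is_cokernel C x y f c e\<close>: the morphism \<open>e : y \<rightarrow> c\<close> is a cokernel of \<open>f : x \<rightarrow> y\<close>.\<close>

definition is_cokernel :: "('o, 'm, 'r) ab_cat_scheme \<Rightarrow> 'o \<Rightarrow> 'o \<Rightarrow> 'm \<Rightarrow> 'o \<Rightarrow> 'm \<Rightarrow> bool" where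
  "is_cokernel C x y f c e \<longleftrightarrow> c \<in> Obj C \<and> e \<in> Hom C y c \<and>
    Comp C x y c e f = Zero C x c \<and>
    (\<forall>z \<in> Obj C. \<forall>g \<in> Hom C y z. Comp C x y z g f = Zero C x z \<longrightarrow>
      (\<exists>!u. u \<in> Hom C c z \<and> Comp C y c z u e = g))"

text \<open>This is the definition of Mac Lane, \<^emph>\<open>Categories for the Working Mathematician\<close>, VIII.3.\<close>

locale abelian_category = preadditive_category C
  for C :: "('o, 'm, 'r) ab_cat_scheme" +
  assumes ex_zero_object: "\<exists>z. zero_object C z"
    and ex_biproduct: "\<lbrakk>x \<in> Obj C; y \<in> Obj C\<rbrakk> \<Longrightarrow> \<exists>b i j p q. biproduct C x y b i j p q"
    and ex_kernel: "\<lbrakk>x \<in> Obj C; y \<in> Obj C; f \<in> Hom C x y\<rbrakk> \<Longrightarrow> \<exists>k m. is_kernel C x y f k m"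
    and ex_cokernel: "\<lbrakk>x \<in> Obj C; y \<in> Obj C; f \<in> Hom C x y\<rbrakk> \<Longrightarrow> \<exists>c e. is_cokernel C x y f c e"
    and monic_is_kernel:
      "\<lbrakk>x \<in> Obj C; y \<in> Obj C; monic C x y m\<rbrakk>
        \<Longrightarrow> \<exists>z \<in> Obj C. \<exists>f \<in> Hom C y z. is_kernel C y z f x m"
    and epic_is_cokernel:
      "\<lbrakk>x \<in> Obj C; y \<in> Obj C; epic C x y e\<rbrakk>
        \<Longrightarrow> \<exists>w \<in> Obj C. \<exists>f \<in> Hom C w x. is_cokernel C w x f y e"

text \<open>
  A \<open>\<int>\<close>-indexed diagram: \<open>ob X n\<close> is the object in degree \<open>n\<close>, and \<open>diff X n\<close> is the
  differential from degree \<open>n\<close> to degree \<open>n + 1\<close>.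
\<close>

record ('o, 'm) diagram =
  ob :: "int \<Rightarrow> 'o"
  diff :: "int \<Rightarrow> 'm"

definition inf_complex :: "('o, 'm, 'r) cat_scheme \<Rightarrow> ('o, 'm) diagram \<Rightarrow> bool" where
  "inf_complex A X \<longleftrightarrow> (\<forall>n. ob X n \<in> Obj A \<and> diff X n \<in> Hom A (ob X n) (ob X (n + 1)))"

definition complex_morphism ::
    "('o, 'm, 'r) cat_scheme \<Rightarrow> ('o, 'm) diagram \<Rightarrow> ('o, 'm) diagram \<Rightarrow> (int \<Rightarrow> 'm) \<Rightarrow> bool" where
  "complex_morphism A X Y g \<longleftrightarrow>
    (\<forall>i. g i \<in> Hom A (ob X i) (ob Y i) \<and>
      Comp A (ob X i) (ob X (i + 1)) (ob Y (i + 1)) (g (i + 1)) (diff X i) =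
      Comp A (ob X i) (ob Y i) (ob Y (i + 1)) (diff Y i) (g i))"

definition C_inf :: "('o, 'm, 'r) ab_cat_scheme \<Rightarrow> (('o, 'm) diagram, int \<Rightarrow> 'm) ab_cat" where
  "C_inf A =
    \<lparr>Obj = {X. inf_complex A X},
     Hom = (\<lambda>X Y. {g. complex_morphism A X Y g}),
     Id = (\<lambda>X i. Id A (ob X i)),
     Comp = (\<lambda>X Y Z g f i. Comp A (ob X i) (ob Y i) (ob Z i) (g i) (f i)),
     Zero = (\<lambda>X Y i. Zero A (ob X i) (ob Y i)),
     Add = (\<lambda>X Y f g i. Add A (ob X i) (ob Y i) (f i) (g i))\<rparr>"

text \<open>\<open>diff_pow A X k n\<close> is the \<open>k\<close>-fold composite \<open>d\<^sup>k\<close> from degree \<open>n\<close> to degree \<open>n + k\<close>.\<close>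

primrec diff_pow :: "('o, 'm, 'r) cat_scheme \<Rightarrow> ('o, 'm) diagram \<Rightarrow> nat \<Rightarrow> int \<Rightarrow> 'm" where
  "diff_pow A X 0 n = Id A (ob X n)"
| "diff_pow A X (Suc k) n =
    Comp A (ob X n) (ob X (n + int k)) (ob X (n + int k + 1)) (diff X (n + int k)) (diff_pow A X k n)"

definition C_N :: "('o, 'm, 'r) ab_cat_scheme \<Rightarrow> nat \<Rightarrow> (('o, 'm) diagram, int \<Rightarrow> 'm) ab_cat" where
  "C_N A N = full_subcategory (C_inf A)
    (\<lambda>X. \<forall>n. diff_pow A X N n = Zero A (ob X n) (ob X (n + int N)))"

end

theory Submission
  imports Defs
begin

text \<open>
  Everything about complexes reduces to a statement in each degree.  Kernels, cokernels, biproducts and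
  a zero object of \<open>C_inf A\<close> are built degreewise: choose the object of \<open>A\<close> in each degree; its
  universal property induces the differentials.  The uniqueness part of the same property makes the
  mediating morphisms commute with the differentials, so a morphism that is a kernel in every degree
  is a kernel of complexes.

  The substantial axiom is that monomorphisms are kernels.  A monomorphism of complexes has to be
  compared with monomorphisms of \<open>A\<close>, although an object of \<open>A\<close> is not a complex and cannot serve as
  a test object directly.  The bridge is that in a preadditive category \<open>f\<close> is monic if and only if its
  kernel is the zero morphism, and this can be read off in each degree because kernels can
  (\<open>degreewise_monic\<close>).  In \<open>A\<close> a monomorphism is the kernel of its cokernel, so the degreewise
  cokernel of a monomorphism of complexes has that monomorphism as its kernel.  The argument for
  epimorphisms is dual.

  For \<open>C_N A N\<close>, a full subcategory of an abelian category that contains a zero object and is closed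
  under kernels, cokernels and biproducts is abelian (\<open>abelian_full_subcategory\<close>).  The condition
  \<open>d\<^sup>N = 0\<close> has these closure properties because morphisms of complexes commute with \<open>d\<^sup>N\<close>:
  it passes along a degreewise monomorphism \<open>m : K \<rightarrow> X\<close>, since \<open>m \<circ> d\<^sup>N = d\<^sup>N \<circ> m = 0\<close> and \<open>m\<close> can be
  cancelled, dually along degreewise epimorphisms, and to biproducts by additivity.
\<close>

section \<open>Kernels, cokernels and cancellation in preadditive categories\<close>

context preadditive_category
begin

lemma Zero_in_Hom: "\<lbrakk>x \<in> Obj C; y \<in> Obj C\<rbrakk> \<Longrightarrow> Zero C x y \<in> Hom C x y"
  using comm_group.axioms(2)[OF hom_comm_group, THEN group.is_monoid, THEN monoid.one_closed]
  by (simp add: hom_group_def)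

lemma Add_in_Hom:
  "\<lbrakk>x \<in> Obj C; y \<in> Obj C; f \<in> Hom C x y; g \<in> Hom C x y\<rbrakk> \<Longrightarrow> Add C x y f g \<in> Hom C x y"
  using comm_group.axioms(2)[OF hom_comm_group, THEN group.is_monoid, THEN monoid.m_closed]
  by (simp add: hom_group_def)

lemma Add_Zero_left: "\<lbrakk>x \<in> Obj C; y \<in> Obj C; f \<in> Hom C x y\<rbrakk> \<Longrightarrow> Add C x y (Zero C x y) f = f"
  using comm_group.axioms(2)[OF hom_comm_group, THEN group.is_monoid, THEN monoid.l_one]
  by (simp add: hom_group_def)

lemma Add_Zero_right: "\<lbrakk>x \<in> Obj C; y \<in> Obj C; f \<in> Hom C x y\<rbrakk> \<Longrightarrow> Add C x y f (Zero C x y) = f"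
  using comm_group.axioms(2)[OF hom_comm_group, THEN group.is_monoid, THEN monoid.r_one]
  by (simp add: hom_group_def)

lemma Add_idem_imp_Zero:
  assumes "x \<in> Obj C" "y \<in> Obj C" "f \<in> Hom C x y" "Add C x y f f = f"
  shows "f = Zero C x y"
proof -
  interpret G: comm_group "hom_group C x y"
    using assms(1,2) by (rule hom_comm_group)
  show ?thesis
    using G.r_cancel_one[of f f] assms(3,4) by (simp add: hom_group_def)
qed

lemma Comp_Zero_right:
  assumes "x \<in> Obj C" "y \<in> Obj C" "z \<in> Obj C" "g \<in> Hom C y z"
  shows "Comp C x y z g (Zero C x y) = Zero C x z"
  using assms Comp_Add_right[of x y z "Zero C x y" "Zero C x y" g]
  by (intro Add_idem_imp_Zero) (simp_all add: Zero_in_Hom Comp_in_Hom Add_Zero_left)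

lemma Comp_Zero_left:
  assumes "x \<in> Obj C" "y \<in> Obj C" "z \<in> Obj C" "f \<in> Hom C x y"
  shows "Comp C x y z (Zero C y z) f = Zero C x z"
  using assms Comp_Add_left[of x y z f "Zero C y z" "Zero C y z"]
  by (intro Add_idem_imp_Zero) (simp_all add: Zero_in_Hom Comp_in_Hom Add_Zero_left)

lemmas hom_simps = Id_in_Hom Comp_in_Hom Zero_in_Hom Add_in_Hom Id_left Id_right
  Add_Zero_left Add_Zero_right Comp_Zero_left Comp_Zero_right

definition Neg where
  "Neg x y f = inv\<^bsub>hom_group C x y\<^esub> f"

lemma Neg_in_Hom: "\<lbrakk>x \<in> Obj C; y \<in> Obj C; f \<in> Hom C x y\<rbrakk> \<Longrightarrow> Neg x y f \<in> Hom C x y"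
  using group.inv_closed[OF comm_group.axioms(2)[OF hom_comm_group]]
  by (simp add: hom_group_def Neg_def)

lemma Add_Neg_left: "\<lbrakk>x \<in> Obj C; y \<in> Obj C; f \<in> Hom C x y\<rbrakk> \<Longrightarrow> Add C x y (Neg x y f) f = Zero C x y"
  using group.l_inv[OF comm_group.axioms(2)[OF hom_comm_group]]
  by (simp add: hom_group_def Neg_def)

lemma eq_Neg_if_Add_Zero:
  assumes "x \<in> Obj C" "y \<in> Obj C" "f \<in> Hom C x y" "g \<in> Hom C x y" "Add C x y f g = Zero C x y"
  shows "f = Neg x y g"
proof -
  interpret G: comm_group "hom_group C x y"
    using assms(1,2) by (rule hom_comm_group)
  show ?thesis
    using G.inv_equality[of f g] assms(3-5) by (simp add: hom_group_def Neg_def)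
qed

lemma Comp_Neg_right:
  assumes "x \<in> Obj C" "y \<in> Obj C" "z \<in> Obj C" "f \<in> Hom C x y" "g \<in> Hom C y z"
  shows "Comp C x y z g (Neg x y f) = Neg x z (Comp C x y z g f)"
  using assms Comp_Add_right[of x y z "Neg x y f" f g]
  by (intro eq_Neg_if_Add_Zero) (simp_all add: hom_simps Neg_in_Hom Add_Neg_left)

lemma Comp_Neg_left:
  assumes "x \<in> Obj C" "y \<in> Obj C" "z \<in> Obj C" "f \<in> Hom C x y" "g \<in> Hom C y z"
  shows "Comp C x y z (Neg y z g) f = Neg x z (Comp C x y z g f)"
  using assms Comp_Add_left[of x y z f "Neg y z g" g]
  by (intro eq_Neg_if_Add_Zero) (simp_all add: hom_simps Neg_in_Hom Add_Neg_left)

lemma eq_if_difference_Zero: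
  assumes "x \<in> Obj C" "y \<in> Obj C" "f \<in> Hom C x y" "g \<in> Hom C x y"
    and "Add C x y (Neg x y f) g = Zero C x y"
  shows "f = g"
proof -
  interpret G: comm_group "hom_group C x y"
    using assms(1,2) by (rule hom_comm_group)
  have "Neg x y f = Neg x y g"
    using assms by (intro eq_Neg_if_Add_Zero) (simp_all add: Neg_in_Hom)
  then show ?thesis
    using G.inv_inj assms(3,4) by (auto simp: hom_group_def Neg_def dest: inj_onD)
qed

lemma monicI:
  assumes "x \<in> Obj C" "y \<in> Obj C" "f \<in> Hom C x y"
    and *: "\<And>w g. \<lbrakk>w \<in> Obj C; g \<in> Hom C w x; Comp C w x y f g = Zero C w y\<rbrakk> \<Longrightarrow> g = Zero C w x"
  shows "monic C x y f"
  unfolding monic_def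
proof (intro conjI ballI impI)
  fix w g h
  assume w: "w \<in> Obj C" "g \<in> Hom C w x" "h \<in> Hom C w x"
    and eq: "Comp C w x y f g = Comp C w x y f h"
  have "Comp C w x y f (Add C w x (Neg w x g) h) = Zero C w y"
    using assms(1-3) w eq
    by (simp add: Comp_Add_right Comp_Neg_right Add_Neg_left Neg_in_Hom Comp_in_Hom)
  then have "Add C w x (Neg w x g) h = Zero C w x"
    using assms(1) w by (intro *) (simp_all add: Add_in_Hom Neg_in_Hom)
  then show "g = h"
    by (rule eq_if_difference_Zero[OF w(1) assms(1) w(2,3)])
qed (use assms(3) in simp)

lemma epicI:
  assumes "x \<in> Obj C" "y \<in> Obj C" "f \<in> Hom C x y"
    and *: "\<And>z g. \<lbrakk>z \<in> Obj C; g \<in> Hom C y z; Comp C x y z g f = Zero C x z\<rbrakk> \<Longrightarrow> g = Zero C y z"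
  shows "epic C x y f"
  unfolding epic_def
proof (intro conjI ballI impI)
  fix z g h
  assume z: "z \<in> Obj C" "g \<in> Hom C y z" "h \<in> Hom C y z"
    and eq: "Comp C x y z g f = Comp C x y z h f"
  have "Comp C x y z (Add C y z (Neg y z g) h) f = Zero C x z"
    using assms(1-3) z eq
    by (simp add: Comp_Add_left Comp_Neg_left Add_Neg_left Neg_in_Hom Comp_in_Hom)
  then have "Add C y z (Neg y z g) h = Zero C y z"
    using assms(2) z by (intro *) (simp_all add: Add_in_Hom Neg_in_Hom)
  then show "g = h"
    by (rule eq_if_difference_Zero[OF assms(2) z(1) z(2,3)])
qed (use assms(3) in simp)

lemma kernel_cancel:
  assumes "is_kernel C x y f k m" "x \<in> Obj C" "y \<in> Obj C" "f \<in> Hom C x y"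
    and "w \<in> Obj C" "u \<in> Hom C w k" "v \<in> Hom C w k" "Comp C w k x m u = Comp C w k x m v"
  shows "u = v"
proof -
  have k: "k \<in> Obj C" "m \<in> Hom C k x" "Comp C k x y f m = Zero C k y"
    using assms(1) by (simp_all add: is_kernel_def)
  have "Comp C w x y f (Comp C w k x m u) = Zero C w y"
    using assms k Comp_assoc[of w k x y u m f] by (simp add: Comp_Zero_left)
  then have "\<exists>!u'. u' \<in> Hom C w k \<and> Comp C w k x m u' = Comp C w k x m u"
    using assms k unfolding is_kernel_def by (simp add: Comp_in_Hom)
  then show ?thesis
    using assms by auto
qed

lemma cokernel_cancel:
  assumes "is_cokernel C x y f c e" "x \<in> Obj C" "y \<in> Obj C" "f \<in> Hom C x y"
    and "z \<in> Obj C" "u \<in> Hom C c z" "v \<in> Hom C c z" "Comp C y c z u e = Comp C y c z v e"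
  shows "u = v"
proof -
  have c: "c \<in> Obj C" "e \<in> Hom C y c" "Comp C x y c e f = Zero C x c"
    using assms(1) by (simp_all add: is_cokernel_def)
  have "Comp C x y z (Comp C y c z u e) f = Zero C x z"
    using assms c Comp_assoc[of x y c z f e u] by (simp add: Comp_Zero_right)
  then have "\<exists>!u'. u' \<in> Hom C c z \<and> Comp C y c z u' e = Comp C y c z u e"
    using assms c unfolding is_cokernel_def by (simp add: Comp_in_Hom)
  then show ?thesis
    using assms by auto
qed

lemma kernel_monic:
  assumes "is_kernel C x y f k m" "x \<in> Obj C" "y \<in> Obj C" "f \<in> Hom C x y"
  shows "monic C k x m"
  using kernel_cancel[OF assms] assms(1) by (auto simp: monic_def is_kernel_def)

lemma cokernel_epic:
  assumes "is_cokernel C x y f c e" "x \<in> Obj C" "y \<in> Obj C" "f \<in> Hom C x y"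
  shows "epic C y c e"
  using cokernel_cancel[OF assms] assms(1) by (auto simp: epic_def is_cokernel_def)

text \<open>
  Together with \<open>monic_if_kernel_Zero\<close> this characterizes monomorphisms by an equation for one
  morphism.  Unlike the definition, which quantifies over all test objects of the category, the
  equation can be transported to another category in which \<open>f\<close> has the same kernel.
\<close>

lemma kernel_of_monic_Zero:
  assumes "x \<in> Obj C" "y \<in> Obj C" "monic C x y f" "is_kernel C x y f k m"
  shows "m = Zero C k x"
  using assms unfolding monic_def is_kernel_def
  by (metis Comp_Zero_right Zero_in_Hom)

lemma cokernel_of_epic_Zero:
  assumes "x \<in> Obj C" "y \<in> Obj C" "epic C x y f" "is_cokernel C x y f c e"
  shows "e = Zero C y c"
  using assms unfolding epic_def is_cokernel_def
  by (metis Comp_Zero_left Zero_in_Hom)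

lemma monic_if_kernel_Zero:
  assumes "x \<in> Obj C" "y \<in> Obj C" "f \<in> Hom C x y" "is_kernel C x y f k (Zero C k x)"
  shows "monic C x y f"
proof (rule monicI[OF assms(1-3)])
  fix w g assume g: "w \<in> Obj C" "g \<in> Hom C w x" "Comp C w x y f g = Zero C w y"
  then obtain u where "u \<in> Hom C w k" "Comp C w k x (Zero C k x) u = g"
    using assms(4) unfolding is_kernel_def by blast
  then show "g = Zero C w x"
    using assms(1,4) g(1) by (auto simp: is_kernel_def Comp_Zero_left)
qed

lemma epic_if_cokernel_Zero:
  assumes "x \<in> Obj C" "y \<in> Obj C" "f \<in> Hom C x y" "is_cokernel C x y f c (Zero C y c)"
  shows "epic C x y f"
proof (rule epicI[OF assms(1-3)])
  fix z g assume g: "z \<in> Obj C" "g \<in> Hom C y z" "Comp C x y z g f = Zero C x z"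
  then obtain u where "u \<in> Hom C c z" "Comp C y c z u (Zero C y c) = g"
    using assms(4) unfolding is_cokernel_def by blast
  then show "g = Zero C y z"
    using assms(2,4) g(1) by (auto simp: is_cokernel_def Comp_Zero_right)
qed

text \<open>
  As \<open>f \<circ> m = 0\<close>, the morphism \<open>f\<close> factors through the cokernel \<open>e\<close> of \<open>m\<close>.  Hence everything
  annihilated by \<open>e\<close> is annihilated by \<open>f\<close> and lifts along \<open>m\<close>.  This replaces the unspecified \<open>f\<close> in
  \<open>monic_is_kernel\<close> by a canonical choice; only a canonical choice can be made in all degrees
  compatibly with differentials.
\<close>

lemma kernel_of_cokernel:
  assumes "x \<in> Obj C" "y \<in> Obj C" "z \<in> Obj C" "f \<in> Hom C y z"
    and ker: "is_kernel C y z f x m" and coker: "is_cokernel C x y m c e"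
  shows "is_kernel C y c e x m"
proof -
  have m: "m \<in> Hom C x y" "Comp C x y z f m = Zero C x z"
    using ker by (simp_all add: is_kernel_def)
  have c: "c \<in> Obj C" "e \<in> Hom C y c" "Comp C x y c e m = Zero C x c"
    using coker by (simp_all add: is_cokernel_def)
  obtain v where v: "v \<in> Hom C c z" "Comp C y c z v e = f"
    using coker m assms(1-4) unfolding is_cokernel_def by blast
  have "\<exists>!u. u \<in> Hom C w x \<and> Comp C w x y m u = g"
    if w: "w \<in> Obj C" "g \<in> Hom C w y" "Comp C w y c e g = Zero C w c" for w g
  proof -
    have "Comp C w y z f g = Zero C w z"
      using v w c assms(1-4) Comp_assoc[of w y c z g e v] by (simp add: Comp_Zero_right)
    then show ?thesis
      using ker w unfolding is_kernel_def by blast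
  qed
  then show ?thesis
    using assms(1) m c unfolding is_kernel_def by blast
qed

lemma cokernel_of_kernel:
  assumes "w \<in> Obj C" "x \<in> Obj C" "y \<in> Obj C" "f \<in> Hom C w x"
    and coker: "is_cokernel C w x f y e" and ker: "is_kernel C x y e k m"
  shows "is_cokernel C k x m y e"
proof -
  have e: "e \<in> Hom C x y" "Comp C w x y e f = Zero C w y"
    using coker by (simp_all add: is_cokernel_def)
  have k: "k \<in> Obj C" "m \<in> Hom C k x" "Comp C k x y e m = Zero C k y"
    using ker by (simp_all add: is_kernel_def)
  obtain v where v: "v \<in> Hom C w k" "Comp C w k x m v = f"
    using ker e assms(1-4) unfolding is_kernel_def by blast
  have "\<exists>!u. u \<in> Hom C y z \<and> Comp C x y z u e = g"
    if z: "z \<in> Obj C" "g \<in> Hom C x z" "Comp C k x z g m = Zero C k z" for z g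
  proof -
    have "Comp C w x z g f = Zero C w z"
      using v z k assms(1-4) Comp_assoc[of w k x z v m g] by (simp add: Comp_Zero_left)
    then show ?thesis
      using coker z unfolding is_cokernel_def by blast
  qed
  then show ?thesis
    using assms(3) e k unfolding is_cokernel_def by blast
qed

text \<open>
  Inserting \<open>i \<circ> p + j \<circ> q = id\<close> into the middle of \<open>q \<circ> i\<close> gives \<open>q \<circ> i = q \<circ> i + q \<circ> i\<close>.
\<close>

lemma biproduct_mixed_Zero:
  assumes "x \<in> Obj C" "y \<in> Obj C" "biproduct C x y b i j p q"
  shows "Comp C x b y q i = Zero C x y" "Comp C y b x p j = Zero C y x"
proof -
  have b: "b \<in> Obj C" "i \<in> Hom C x b" "j \<in> Hom C y b" "p \<in> Hom C b x" "q \<in> Hom C b y"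
    "Comp C x b x p i = Id C x" "Comp C y b y q j = Id C y"
    "Add C b b (Comp C b x b i p) (Comp C b y b j q) = Id C b"
    using assms(3) by (simp_all add: biproduct_def)
  let ?h = "Comp C x b y q i"
  have "?h = Comp C x b y q (Comp C x b b (Add C b b (Comp C b x b i p) (Comp C b y b j q)) i)"
    using assms b by (simp add: Id_left)
  also have "\<dots> = Add C x y ?h ?h"
    using assms(1,2) b(1-7)
    by (simp add: Comp_Add_left Comp_Add_right Comp_in_Hom Comp_assoc Id_right)
      (simp add: Comp_assoc[symmetric] Comp_in_Hom Id_left)
  finally show "?h = Zero C x y"
    using assms b by (intro Add_idem_imp_Zero) (simp_all add: Comp_in_Hom)
  let ?k = "Comp C y b x p j"
  have "?k = Comp C y b x p (Comp C y b b (Add C b b (Comp C b x b i p) (Comp C b y b j q)) j)"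
    using assms b by (simp add: Id_left)
  also have "\<dots> = Add C y x ?k ?k"
    using assms(1,2) b(1-7)
    by (simp add: Comp_Add_left Comp_Add_right Comp_in_Hom Comp_assoc Id_right)
      (simp add: Comp_assoc[symmetric] Comp_in_Hom Id_left)
  finally show "?k = Zero C y x"
    using assms b by (intro Add_idem_imp_Zero) (simp_all add: Comp_in_Hom)
qed

end

context abelian_category
begin

lemma monic_kernel_of_cokernel:
  assumes "x \<in> Obj C" "y \<in> Obj C" "monic C x y m" "is_cokernel C x y m c e"
  shows "is_kernel C y c e x m"
  using monic_is_kernel[OF assms(1-3)] kernel_of_cokernel assms by blast

lemma epic_cokernel_of_kernel:
  assumes "x \<in> Obj C" "y \<in> Obj C" "epic C x y e" "is_kernel C x y e k m"
  shows "is_cokernel C k x m y e"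
  using epic_is_cokernel[OF assms(1-3)] cokernel_of_kernel assms by blast

end


section \<open>Full subcategories\<close>

lemma full_subcategory_simps:
  "Obj (full_subcategory C P) = {x \<in> Obj C. P x}"
  "Hom (full_subcategory C P) = Hom C"
  "Id (full_subcategory C P) = Id C"
  "Comp (full_subcategory C P) = Comp C"
  by (simp_all add: full_subcategory_def)

lemma full_subcategory_ab_simps:
  "Zero (full_subcategory C P) = Zero C"
  "Add (full_subcategory C P) = Add C"
  "hom_group (full_subcategory C P) = hom_group C"
  by (simp_all add: full_subcategory_def hom_group_def fun_eq_iff)

lemma (in preadditive_category) preadditive_full_subcategory:
  "preadditive_category (full_subcategory C P)"
  by (intro preadditive_category.intro category.intro preadditive_category_axioms.intro)
    (simp_all add: full_subcategory_simps full_subcategory_ab_simps Id_in_Hom Comp_in_Hom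
      Id_left Id_right Comp_assoc hom_comm_group Comp_Add_left Comp_Add_right)

lemma is_kernel_full_subcategory:
  "\<lbrakk>is_kernel C x y f k m; P k\<rbrakk> \<Longrightarrow> is_kernel (full_subcategory C P) x y f k m"
  by (simp add: is_kernel_def full_subcategory_simps full_subcategory_ab_simps)

lemma is_cokernel_full_subcategory:
  "\<lbrakk>is_cokernel C x y f c e; P c\<rbrakk> \<Longrightarrow> is_cokernel (full_subcategory C P) x y f c e"
  by (simp add: is_cokernel_def full_subcategory_simps full_subcategory_ab_simps)

text \<open>
  Universal properties of objects of the subcategory are inherited, because fewer test objects remain.
  A monomorphism of the subcategory could a priori fail to be monic in \<open>C\<close>, where there are more test
  objects; but its kernel in \<open>C\<close> lies in the subcategory, and is therefore zero.
\<close>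

theorem (in abelian_category) abelian_full_subcategory:
  assumes zero: "zero_object C z" "P z"
    and biprod: "\<And>x y b i j p q. \<lbrakk>x \<in> Obj C; y \<in> Obj C; P x; P y; biproduct C x y b i j p q\<rbrakk> \<Longrightarrow> P b"
    and ker: "\<And>x y f k m. \<lbrakk>x \<in> Obj C; y \<in> Obj C; P x; P y; f \<in> Hom C x y; is_kernel C x y f k m\<rbrakk> \<Longrightarrow> P k"
    and coker: "\<And>x y f c e. \<lbrakk>x \<in> Obj C; y \<in> Obj C; P x; P y; f \<in> Hom C x y; is_cokernel C x y f c e\<rbrakk> \<Longrightarrow> P c"
  shows "abelian_category (full_subcategory C P)"
proof -
  let ?D = "full_subcategory C P"
  note simps = full_subcategory_simps full_subcategory_ab_simps
  interpret D: preadditive_category ?D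
    by (rule preadditive_full_subcategory)
  show ?thesis
  proof
    have "zero_object ?D z"
      using zero by (simp add: zero_object_def simps)
    then show "\<exists>z. zero_object ?D z" ..
  next
    fix x y assume xy: "x \<in> Obj ?D" "y \<in> Obj ?D"
    then obtain b i j p q where b: "biproduct C x y b i j p q"
      using ex_biproduct[of x y] by (auto simp: simps)
    then have "P b"
      using biprod[OF _ _ _ _ b] xy by (simp add: simps)
    with b have "biproduct ?D x y b i j p q"
      by (simp add: biproduct_def simps)
    then show "\<exists>b i j p q. biproduct ?D x y b i j p q"
      by blast
  next
    fix x y f assume xy: "x \<in> Obj ?D" "y \<in> Obj ?D" "f \<in> Hom ?D x y"
    then have xyC: "x \<in> Obj C" "y \<in> Obj C" "P x" "P y" "f \<in> Hom C x y"
      by (simp_all add: simps)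
    then obtain k m where k: "is_kernel C x y f k m"
      using ex_kernel by blast
    show "\<exists>k m. is_kernel ?D x y f k m"
      using is_kernel_full_subcategory[OF k, of P] ker[OF xyC k] by metis
  next
    fix x y f assume xy: "x \<in> Obj ?D" "y \<in> Obj ?D" "f \<in> Hom ?D x y"
    then have xyC: "x \<in> Obj C" "y \<in> Obj C" "P x" "P y" "f \<in> Hom C x y"
      by (simp_all add: simps)
    then obtain c e where c: "is_cokernel C x y f c e"
      using ex_cokernel by blast
    show "\<exists>c e. is_cokernel ?D x y f c e"
      using is_cokernel_full_subcategory[OF c, of P] coker[OF xyC c] by metis
  next
    fix x y m assume xy: "x \<in> Obj ?D" "y \<in> Obj ?D" and m: "monic ?D x y m"
    then have xyC: "x \<in> Obj C" "y \<in> Obj C" "P x" "P y" "m \<in> Hom C x y"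
      by (simp_all add: simps monic_def)
    obtain k n where k: "is_kernel C x y m k n"
      using ex_kernel xyC by blast
    then have "n = Zero C k x"
      using D.kernel_of_monic_Zero[OF xy m is_kernel_full_subcategory[OF k, of P, OF ker[OF xyC k]]]
      by (simp add: simps)
    with k have "monic C x y m"
      using monic_if_kernel_Zero xyC by blast
    moreover obtain c e where c: "is_cokernel C x y m c e"
      using ex_cokernel xyC by blast
    ultimately have "is_kernel C y c e x m"
      using monic_kernel_of_cokernel xyC by blast
    then have "is_kernel ?D y c e x m"
      using xyC(3) by (rule is_kernel_full_subcategory)
    moreover have "c \<in> Obj ?D" "e \<in> Hom ?D y c"
      using c coker[OF xyC c] by (auto simp: simps is_cokernel_def)
    ultimately show "\<exists>z \<in> Obj ?D. \<exists>f \<in> Hom ?D y z. is_kernel ?D y z f x m"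
      by blast
  next
    fix x y e assume xy: "x \<in> Obj ?D" "y \<in> Obj ?D" and e: "epic ?D x y e"
    then have xyC: "x \<in> Obj C" "y \<in> Obj C" "P x" "P y" "e \<in> Hom C x y"
      by (simp_all add: simps epic_def)
    obtain c n where c: "is_cokernel C x y e c n"
      using ex_cokernel xyC by blast
    then have "n = Zero C y c"
      using D.cokernel_of_epic_Zero[OF xy e is_cokernel_full_subcategory[OF c, of P, OF coker[OF xyC c]]]
      by (simp add: simps)
    with c have "epic C x y e"
      using epic_if_cokernel_Zero xyC by blast
    moreover obtain k m where k: "is_kernel C x y e k m"
      using ex_kernel xyC by blast
    ultimately have "is_cokernel C k x m y e"
      using epic_cokernel_of_kernel xyC by blast
    then have "is_cokernel ?D k x m y e"
      using xyC(4) by (rule is_cokernel_full_subcategory)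
    moreover have "k \<in> Obj ?D" "m \<in> Hom ?D k x"
      using k ker[OF xyC k] by (auto simp: simps is_kernel_def)
    ultimately show "\<exists>w \<in> Obj ?D. \<exists>f \<in> Hom ?D w x. is_cokernel ?D w x f y e"
      by blast
  qed
qed


section \<open>The additive structure on complexes\<close>

lemma C_inf_simps:
  "Obj (C_inf A) = {X. inf_complex A X}"
  "Hom (C_inf A) X Y = {g. complex_morphism A X Y g}"
  "Id (C_inf A) X = (\<lambda>i. Id A (ob X i))"
  "Comp (C_inf A) X Y Z g f = (\<lambda>i. Comp A (ob X i) (ob Y i) (ob Z i) (g i) (f i))"
  "Zero (C_inf A) X Y = (\<lambda>i. Zero A (ob X i) (ob Y i))"
  "Add (C_inf A) X Y f g = (\<lambda>i. Add A (ob X i) (ob Y i) (f i) (g i))"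
  by (simp_all add: C_inf_def)

lemma inf_complexD:
  assumes "inf_complex A X"
  shows "ob X n \<in> Obj A" "diff X n \<in> Hom A (ob X n) (ob X (n + 1))"
  using assms by (simp_all add: inf_complex_def)

lemma complex_morphismD:
  assumes "complex_morphism A X Y g"
  shows "g i \<in> Hom A (ob X i) (ob Y i)"
    and "Comp A (ob X i) (ob X (i + 1)) (ob Y (i + 1)) (g (i + 1)) (diff X i) =
      Comp A (ob X i) (ob Y i) (ob Y (i + 1)) (diff Y i) (g i)"
  using assms by (simp_all add: complex_morphism_def)

lemma (in category) complex_morphism_Comp:
  assumes X: "inf_complex C X" and Y: "inf_complex C Y" and Z: "inf_complex C Z"
    and f: "complex_morphism C X Y f" and g: "complex_morphism C Y Z g"
  shows "complex_morphism C X Z (\<lambda>i. Comp C (ob X i) (ob Y i) (ob Z i) (g i) (f i))"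
  unfolding complex_morphism_def
proof (intro allI conjI)
  fix i
  note t = inf_complexD[OF X] inf_complexD[OF Y] inf_complexD[OF Z]
    complex_morphismD(1)[OF f] complex_morphismD(1)[OF g]
  show "Comp C (ob X i) (ob Y i) (ob Z i) (g i) (f i) \<in> Hom C (ob X i) (ob Z i)"
    by (simp add: t Comp_in_Hom)
  show "Comp C (ob X i) (ob X (i + 1)) (ob Z (i + 1))
      (Comp C (ob X (i + 1)) (ob Y (i + 1)) (ob Z (i + 1)) (g (i + 1)) (f (i + 1))) (diff X i) =
    Comp C (ob X i) (ob Z i) (ob Z (i + 1)) (diff Z i) (Comp C (ob X i) (ob Y i) (ob Z i) (g i) (f i))"
    by (simp add: t Comp_assoc complex_morphismD(2)[OF f])
      (simp add: t Comp_assoc[symmetric] complex_morphismD(2)[OF g])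
qed

context preadditive_category
begin

lemma complex_morphism_Id: "inf_complex C X \<Longrightarrow> complex_morphism C X X (\<lambda>i. Id C (ob X i))"
  by (simp add: complex_morphism_def hom_simps inf_complexD)

lemma complex_morphism_Zero:
  "\<lbrakk>inf_complex C X; inf_complex C Y\<rbrakk> \<Longrightarrow> complex_morphism C X Y (\<lambda>i. Zero C (ob X i) (ob Y i))"
  by (simp add: complex_morphism_def hom_simps inf_complexD)

lemma complex_morphism_Add:
  assumes "inf_complex C X" "inf_complex C Y" "complex_morphism C X Y f" "complex_morphism C X Y g"
  shows "complex_morphism C X Y (\<lambda>i. Add C (ob X i) (ob Y i) (f i) (g i))"
  using assms
  by (simp add: complex_morphism_def[of _ _ _ "\<lambda>i. Add C (ob X i) (ob Y i) (f i) (g i)"]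
      hom_simps inf_complexD complex_morphismD Comp_Add_left Comp_Add_right)

lemma complex_morphism_Neg:
  assumes "inf_complex C X" "inf_complex C Y" "complex_morphism C X Y f"
  shows "complex_morphism C X Y (\<lambda>i. Neg (ob X i) (ob Y i) (f i))"
  using assms
  by (simp add: complex_morphism_def[of _ _ _ "\<lambda>i. Neg (ob X i) (ob Y i) (f i)"]
      Neg_in_Hom inf_complexD complex_morphismD Comp_Neg_left Comp_Neg_right)

lemma preadditive_C_inf: "preadditive_category (C_inf C)"
proof (intro preadditive_category.intro category.intro preadditive_category_axioms.intro)
  fix X Y
  assume "X \<in> Obj (C_inf C)" "Y \<in> Obj (C_inf C)"
  then have XY: "inf_complex C X" "inf_complex C Y"
    by (simp_all add: C_inf_simps)
  have G: "comm_group (hom_group C (ob X i) (ob Y i))" for i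
    using XY by (intro hom_comm_group) (simp_all add: inf_complexD)
  have assoc: "Add C (ob X i) (ob Y i) (Add C (ob X i) (ob Y i) f g) h =
      Add C (ob X i) (ob Y i) f (Add C (ob X i) (ob Y i) g h)"
    if "f \<in> Hom C (ob X i) (ob Y i)" "g \<in> Hom C (ob X i) (ob Y i)" "h \<in> Hom C (ob X i) (ob Y i)"
    for f g h i
    using monoid.m_assoc[OF group.is_monoid[OF comm_group.axioms(2)[OF G[of i]]]] that
    by (simp add: hom_group_def)
  have comm: "Add C (ob X i) (ob Y i) f g = Add C (ob X i) (ob Y i) g f"
    if "f \<in> Hom C (ob X i) (ob Y i)" "g \<in> Hom C (ob X i) (ob Y i)" for f g i
    using comm_monoid.m_comm[OF comm_group.axioms(1)[OF G[of i]]] that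
    by (simp add: hom_group_def)
  show "comm_group (hom_group (C_inf C) X Y)"
  proof (rule comm_groupI)
    fix f assume "f \<in> carrier (hom_group (C_inf C) X Y)"
    then show "\<exists>g \<in> carrier (hom_group (C_inf C) X Y).
        g \<otimes>\<^bsub>hom_group (C_inf C) X Y\<^esub> f = \<one>\<^bsub>hom_group (C_inf C) X Y\<^esub>"
      using XY
      by (intro bexI[of _ "\<lambda>i. Neg (ob X i) (ob Y i) (f i)"])
        (simp_all add: hom_group_def C_inf_simps complex_morphism_Neg Add_Neg_left
          inf_complexD complex_morphismD)
  next
    fix f g assume "f \<in> carrier (hom_group (C_inf C) X Y)" "g \<in> carrier (hom_group (C_inf C) X Y)"
    then show "f \<otimes>\<^bsub>hom_group (C_inf C) X Y\<^esub> g = g \<otimes>\<^bsub>hom_group (C_inf C) X Y\<^esub> f"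
      by (simp add: hom_group_def C_inf_simps complex_morphismD(1) comm)
  qed (use XY in \<open>simp_all add: hom_group_def C_inf_simps complex_morphism_Zero complex_morphism_Add
      complex_morphismD(1) inf_complexD assoc hom_simps\<close>)
qed (simp_all add: C_inf_simps complex_morphism_Id complex_morphism_Comp inf_complexD
    complex_morphismD(1) hom_simps Comp_assoc Comp_Add_left Comp_Add_right)

end


section \<open>Limits and colimits of complexes are computed degreewise\<close>

context preadditive_category
begin

text \<open>
  The degreewise lifts of a morphism commute with the differentials, since this can be tested after
  composition with the kernel, which is cancellable.
\<close>

lemma degreewise_kernel:
  assumes X: "inf_complex C X" and Y: "inf_complex C Y" and K: "inf_complex C K"
    and f: "complex_morphism C X Y f" and m: "complex_morphism C K X m"
    and ker: "\<And>n. is_kernel C (ob X n) (ob Y n) (f n) (ob K n) (m n)"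
  shows "is_kernel (C_inf C) X Y f K m"
proof -
  have "\<exists>!u. complex_morphism C W K u \<and> (\<lambda>i. Comp C (ob W i) (ob K i) (ob X i) (m i) (u i)) = g"
    if W: "inf_complex C W" and g: "complex_morphism C W X g"
      and fg: "\<And>i. Comp C (ob W i) (ob X i) (ob Y i) (f i) (g i) = Zero C (ob W i) (ob Y i)" for W g
  proof -
    note t = inf_complexD[OF X] inf_complexD[OF Y] inf_complexD[OF K] inf_complexD[OF W]
      complex_morphismD(1)[OF f] complex_morphismD(1)[OF m] complex_morphismD(1)[OF g]
    have "\<exists>u. u \<in> Hom C (ob W n) (ob K n) \<and> Comp C (ob W n) (ob K n) (ob X n) (m n) u = g n" for n
      using ker[of n] fg[of n] t unfolding is_kernel_def by blast
    then obtain u where u: "u n \<in> Hom C (ob W n) (ob K n)"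
      "Comp C (ob W n) (ob K n) (ob X n) (m n) (u n) = g n" for n
      by metis
    have "Comp C (ob W n) (ob W (n+1)) (ob K (n+1)) (u (n+1)) (diff W n) =
        Comp C (ob W n) (ob K n) (ob K (n+1)) (diff K n) (u n)" for n
    proof (rule kernel_cancel[OF ker[of "n+1"]])
      have "Comp C (ob W n) (ob K (n+1)) (ob X (n+1)) (m (n+1))
          (Comp C (ob W n) (ob W (n+1)) (ob K (n+1)) (u (n+1)) (diff W n)) =
        Comp C (ob W n) (ob W (n+1)) (ob X (n+1)) (g (n+1)) (diff W n)"
        by (simp add: t u Comp_assoc[symmetric])
      also have "\<dots> = Comp C (ob W n) (ob X n) (ob X (n+1)) (diff X n) (g n)"
        by (rule complex_morphismD(2)[OF g])
      also have "\<dots> = Comp C (ob W n) (ob K n) (ob X (n+1))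
          (Comp C (ob K n) (ob X n) (ob X (n+1)) (diff X n) (m n)) (u n)"
        by (simp add: t u Comp_assoc)
      also have "\<dots> = Comp C (ob W n) (ob K (n+1)) (ob X (n+1)) (m (n+1))
          (Comp C (ob W n) (ob K n) (ob K (n+1)) (diff K n) (u n))"
        by (simp add: t u Comp_assoc complex_morphismD(2)[OF m, symmetric])
      finally show "Comp C (ob W n) (ob K (n+1)) (ob X (n+1)) (m (n+1))
          (Comp C (ob W n) (ob W (n+1)) (ob K (n+1)) (u (n+1)) (diff W n)) = \<dots>" .
    qed (simp_all add: t u Comp_in_Hom)
    then have "complex_morphism C W K u"
      using u by (simp add: complex_morphism_def)
    moreover have "v = u" if v: "complex_morphism C W K v"
      "(\<lambda>i. Comp C (ob W i) (ob K i) (ob X i) (m i) (v i)) = g" for v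
    proof
      fix n
      show "v n = u n"
        by (rule kernel_cancel[OF ker[of n], where w = "ob W n"])
          (use t u fun_cong[OF v(2), of n] complex_morphismD(1)[OF v(1)] in simp_all)
    qed
    ultimately show ?thesis
      using u by blast
  qed
  then show ?thesis
    using K m ker unfolding is_kernel_def by (simp add: C_inf_simps fun_eq_iff)
qed

text \<open>
  The dual of \<open>degreewise_kernel\<close>; the cancellable morphism is now the cokernel in the source degree
  of the differential.
\<close>

lemma degreewise_cokernel:
  assumes X: "inf_complex C X" and Y: "inf_complex C Y" and Q: "inf_complex C Q"
    and f: "complex_morphism C X Y f" and e: "complex_morphism C Y Q e"
    and coker: "\<And>n. is_cokernel C (ob X n) (ob Y n) (f n) (ob Q n) (e n)"
  shows "is_cokernel (C_inf C) X Y f Q e"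
proof -
  have "\<exists>!u. complex_morphism C Q Z u \<and> (\<lambda>i. Comp C (ob Y i) (ob Q i) (ob Z i) (u i) (e i)) = g"
    if Z: "inf_complex C Z" and g: "complex_morphism C Y Z g"
      and gf: "\<And>i. Comp C (ob X i) (ob Y i) (ob Z i) (g i) (f i) = Zero C (ob X i) (ob Z i)" for Z g
  proof -
    note t = inf_complexD[OF X] inf_complexD[OF Y] inf_complexD[OF Q] inf_complexD[OF Z]
      complex_morphismD(1)[OF f] complex_morphismD(1)[OF e] complex_morphismD(1)[OF g]
    have "\<exists>u. u \<in> Hom C (ob Q n) (ob Z n) \<and> Comp C (ob Y n) (ob Q n) (ob Z n) u (e n) = g n" for n
      using coker[of n] gf[of n] t unfolding is_cokernel_def by blast
    then obtain u where u: "u n \<in> Hom C (ob Q n) (ob Z n)"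
      "Comp C (ob Y n) (ob Q n) (ob Z n) (u n) (e n) = g n" for n
      by metis
    have "Comp C (ob Q n) (ob Q (n+1)) (ob Z (n+1)) (u (n+1)) (diff Q n) =
        Comp C (ob Q n) (ob Z n) (ob Z (n+1)) (diff Z n) (u n)" for n
    proof (rule cokernel_cancel[OF coker[of n]])
      have "Comp C (ob Y n) (ob Q n) (ob Z (n+1))
          (Comp C (ob Q n) (ob Q (n+1)) (ob Z (n+1)) (u (n+1)) (diff Q n)) (e n) =
        Comp C (ob Y n) (ob Q (n+1)) (ob Z (n+1)) (u (n+1))
          (Comp C (ob Y n) (ob Y (n+1)) (ob Q (n+1)) (e (n+1)) (diff Y n))"
        by (simp add: t u Comp_assoc complex_morphismD(2)[OF e])
      also have "\<dots> = Comp C (ob Y n) (ob Y (n+1)) (ob Z (n+1)) (g (n+1)) (diff Y n)"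
        by (simp add: t u Comp_assoc[symmetric])
      also have "\<dots> = Comp C (ob Y n) (ob Z n) (ob Z (n+1)) (diff Z n) (g n)"
        by (rule complex_morphismD(2)[OF g])
      also have "\<dots> = Comp C (ob Y n) (ob Q n) (ob Z (n+1))
          (Comp C (ob Q n) (ob Z n) (ob Z (n+1)) (diff Z n) (u n)) (e n)"
        by (simp add: t u Comp_assoc)
      finally show "Comp C (ob Y n) (ob Q n) (ob Z (n+1))
          (Comp C (ob Q n) (ob Q (n+1)) (ob Z (n+1)) (u (n+1)) (diff Q n)) (e n) = \<dots>" .
    qed (simp_all add: t u Comp_in_Hom)
    then have "complex_morphism C Q Z u"
      using u by (simp add: complex_morphism_def)
    moreover have "v = u" if v: "complex_morphism C Q Z v"
      "(\<lambda>i. Comp C (ob Y i) (ob Q i) (ob Z i) (v i) (e i)) = g" for v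
    proof
      fix n
      show "v n = u n"
        by (rule cokernel_cancel[OF coker[of n], where z = "ob Z n"])
          (use t u fun_cong[OF v(2), of n] complex_morphismD(1)[OF v(1)] in simp_all)
    qed
    ultimately show ?thesis
      using u by blast
  qed
  then show ?thesis
    using Q e coker unfolding is_cokernel_def by (simp add: C_inf_simps fun_eq_iff)
qed

end

context abelian_category
begin

text \<open>
  The differential of the kernel is the restriction of the differential \<open>d\<close> of \<open>X\<close>: it exists because
  \<open>f \<circ> d \<circ> m = d \<circ> f \<circ> m = 0\<close>, and its defining equation says that \<open>m\<close> is a morphism of complexes.
\<close>

lemma ex_degreewise_kernel:
  assumes X: "inf_complex C X" and Y: "inf_complex C Y" and f: "complex_morphism C X Y f"
  obtains K m where "inf_complex C K" "complex_morphism C K X m"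
    "\<And>n. is_kernel C (ob X n) (ob Y n) (f n) (ob K n) (m n)"
proof -
  note t = inf_complexD[OF X] inf_complexD[OF Y] complex_morphismD(1)[OF f]
  have "\<exists>k m. is_kernel C (ob X n) (ob Y n) (f n) k m" for n
    by (rule ex_kernel) (simp_all add: t)
  then obtain k m where ker: "is_kernel C (ob X n) (ob Y n) (f n) (k n) (m n)" for n
    by metis
  then have km: "k n \<in> Obj C" "m n \<in> Hom C (k n) (ob X n)"
    "Comp C (k n) (ob X n) (ob Y n) (f n) (m n) = Zero C (k n) (ob Y n)" for n
    unfolding is_kernel_def by blast+
  have "\<exists>u. u \<in> Hom C (k n) (k (n+1)) \<and> Comp C (k n) (k (n+1)) (ob X (n+1)) (m (n+1)) u =
      Comp C (k n) (ob X n) (ob X (n+1)) (diff X n) (m n)" (is "\<exists>u. ?lift u") for n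
  proof -
    let ?g = "Comp C (k n) (ob X n) (ob X (n+1)) (diff X n) (m n)"
    have "Comp C (k n) (ob X (n+1)) (ob Y (n+1)) (f (n+1)) ?g =
        Comp C (k n) (ob X n) (ob Y (n+1))
          (Comp C (ob X n) (ob X (n+1)) (ob Y (n+1)) (f (n+1)) (diff X n)) (m n)"
      by (simp add: t km Comp_assoc)
    also have "\<dots> = Zero C (k n) (ob Y (n+1))"
      by (simp add: t km Comp_assoc complex_morphismD(2)[OF f] Comp_Zero_right)
    finally have "Comp C (k n) (ob X (n+1)) (ob Y (n+1)) (f (n+1)) ?g = Zero C (k n) (ob Y (n+1))" .
    moreover have "?g \<in> Hom C (k n) (ob X (n+1))"
      by (simp add: t km Comp_in_Hom)
    ultimately show ?thesis
      using ker[of "n+1"] km(1) unfolding is_kernel_def by blast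
  qed
  then obtain d where d: "d n \<in> Hom C (k n) (k (n+1))"
    "Comp C (k n) (k (n+1)) (ob X (n+1)) (m (n+1)) (d n) =
      Comp C (k n) (ob X n) (ob X (n+1)) (diff X n) (m n)" for n
    by metis
  show ?thesis
    by (rule that[of "\<lparr>ob = k, diff = d\<rparr>" m])
      (simp_all add: inf_complex_def complex_morphism_def km d ker)
qed

text \<open>
  Dually, the differential \<open>d\<close> of \<open>Y\<close> descends to the cokernels because \<open>e \<circ> d \<circ> f = e \<circ> f \<circ> d = 0\<close>.
\<close>

lemma ex_degreewise_cokernel:
  assumes X: "inf_complex C X" and Y: "inf_complex C Y" and f: "complex_morphism C X Y f"
  obtains Q e where "inf_complex C Q" "complex_morphism C Y Q e"
    "\<And>n. is_cokernel C (ob X n) (ob Y n) (f n) (ob Q n) (e n)"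
proof -
  note t = inf_complexD[OF X] inf_complexD[OF Y] complex_morphismD(1)[OF f]
  have "\<exists>c e. is_cokernel C (ob X n) (ob Y n) (f n) c e" for n
    by (rule ex_cokernel) (simp_all add: t)
  then obtain c e where coker: "is_cokernel C (ob X n) (ob Y n) (f n) (c n) (e n)" for n
    by metis
  then have ce: "c n \<in> Obj C" "e n \<in> Hom C (ob Y n) (c n)"
    "Comp C (ob X n) (ob Y n) (c n) (e n) (f n) = Zero C (ob X n) (c n)" for n
    unfolding is_cokernel_def by blast+
  have "\<exists>u. u \<in> Hom C (c n) (c (n+1)) \<and> Comp C (ob Y n) (c n) (c (n+1)) u (e n) =
      Comp C (ob Y n) (ob Y (n+1)) (c (n+1)) (e (n+1)) (diff Y n)" for n
  proof -
    let ?g = "Comp C (ob Y n) (ob Y (n+1)) (c (n+1)) (e (n+1)) (diff Y n)"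
    have "Comp C (ob X n) (ob Y n) (c (n+1)) ?g (f n) =
        Comp C (ob X n) (ob Y (n+1)) (c (n+1)) (e (n+1))
          (Comp C (ob X n) (ob X (n+1)) (ob Y (n+1)) (f (n+1)) (diff X n))"
      by (simp add: t ce Comp_assoc complex_morphismD(2)[OF f])
    also have "\<dots> = Zero C (ob X n) (c (n+1))"
      by (simp add: t ce Comp_assoc[symmetric] Comp_Zero_left)
    finally have "Comp C (ob X n) (ob Y n) (c (n+1)) ?g (f n) = Zero C (ob X n) (c (n+1))" .
    moreover have "?g \<in> Hom C (ob Y n) (c (n+1))"
      by (simp add: t ce Comp_in_Hom)
    ultimately show ?thesis
      using coker[of n] ce(1) unfolding is_cokernel_def by blast
  qed
  then obtain d where d: "d n \<in> Hom C (c n) (c (n+1))"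
    "Comp C (ob Y n) (c n) (c (n+1)) (d n) (e n) =
      Comp C (ob Y n) (ob Y (n+1)) (c (n+1)) (e (n+1)) (diff Y n)" for n
    by metis
  show ?thesis
    by (rule that[of "\<lparr>ob = c, diff = d\<rparr>" e])
      (simp_all add: inf_complex_def complex_morphism_def ce d coker)
qed

text \<open>
  The degreewise kernel of \<open>f\<close> is a kernel of complexes, hence the zero morphism.  So the kernel
  of \<open>f\<close> in each degree is zero.
\<close>

lemma degreewise_monic:
  assumes X: "inf_complex C X" and Y: "inf_complex C Y" and f: "monic (C_inf C) X Y f"
  shows "monic C (ob X n) (ob Y n) (f n)"
proof -
  interpret K: preadditive_category "C_inf C"
    by (rule preadditive_C_inf)
  have mor: "complex_morphism C X Y f"
    using f by (simp add: monic_def C_inf_simps)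
  obtain K m where K: "inf_complex C K" "complex_morphism C K X m"
    and ker: "\<And>n. is_kernel C (ob X n) (ob Y n) (f n) (ob K n) (m n)"
    using ex_degreewise_kernel[OF X Y mor] by blast
  have "m = Zero (C_inf C) K X"
    using K.kernel_of_monic_Zero[OF _ _ f degreewise_kernel[OF X Y K(1) mor K(2) ker]] X Y
    by (simp add: C_inf_simps)
  then show ?thesis
    using ker[of n] inf_complexD[OF X] inf_complexD[OF Y] complex_morphismD(1)[OF mor]
    by (intro monic_if_kernel_Zero) (simp_all add: C_inf_simps)
qed

lemma degreewise_epic:
  assumes X: "inf_complex C X" and Y: "inf_complex C Y" and f: "epic (C_inf C) X Y f"
  shows "epic C (ob X n) (ob Y n) (f n)"
proof -
  interpret K: preadditive_category "C_inf C"
    by (rule preadditive_C_inf)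
  have mor: "complex_morphism C X Y f"
    using f by (simp add: epic_def C_inf_simps)
  obtain Q e where Q: "inf_complex C Q" "complex_morphism C Y Q e"
    and coker: "\<And>n. is_cokernel C (ob X n) (ob Y n) (f n) (ob Q n) (e n)"
    using ex_degreewise_cokernel[OF X Y mor] by blast
  have "e = Zero (C_inf C) Y Q"
    using K.cokernel_of_epic_Zero[OF _ _ f degreewise_cokernel[OF X Y Q(1) mor Q(2) coker]] X Y
    by (simp add: C_inf_simps)
  then show ?thesis
    using coker[of n] inf_complexD[OF X] inf_complexD[OF Y] complex_morphismD(1)[OF mor]
    by (intro epic_if_cokernel_Zero) (simp_all add: C_inf_simps)
qed

lemma C_inf_ex_zero_object: "\<exists>Z. zero_object (C_inf C) Z"
proof -
  obtain z where z: "zero_object C z"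
    using ex_zero_object by blast
  then have zO: "z \<in> Obj C"
    by (simp add: zero_object_def)
  have into: "f = Zero C x z" if "x \<in> Obj C" "f \<in> Hom C x z" for x f
    using z that Zero_in_Hom[OF that(1) zO] by (auto simp: zero_object_def)
  have out: "f = Zero C z x" if "x \<in> Obj C" "f \<in> Hom C z x" for x f
    using z that Zero_in_Hom[OF zO that(1)] by (auto simp: zero_object_def)
  define Z where "Z = \<lparr>ob = (\<lambda>_::int. z), diff = (\<lambda>_. Zero C z z)\<rparr>"
  have Z: "inf_complex C Z"
    by (simp add: Z_def inf_complex_def zO Zero_in_Hom)
  have "zero_object (C_inf C) Z"
    unfolding zero_object_def
  proof (intro conjI ballI)
    fix X assume "X \<in> Obj (C_inf C)"
    then have X: "inf_complex C X"
      by (simp add: C_inf_simps)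
    have "f = (\<lambda>i. Zero C (ob X i) (ob Z i))" if "complex_morphism C X Z f" for f
      using complex_morphismD(1)[OF that] into inf_complexD(1)[OF X] by (auto simp: Z_def)
    then show "\<exists>!f. f \<in> Hom (C_inf C) X Z"
      using complex_morphism_Zero[OF X Z] unfolding C_inf_simps by blast
    have "f = (\<lambda>i. Zero C (ob Z i) (ob X i))" if "complex_morphism C Z X f" for f
      using complex_morphismD(1)[OF that] out inf_complexD(1)[OF X] by (auto simp: Z_def)
    then show "\<exists>!f. f \<in> Hom (C_inf C) Z X"
      using complex_morphism_Zero[OF Z X] unfolding C_inf_simps by blast
  qed (use Z in \<open>simp add: C_inf_simps\<close>)
  then show ?thesis ..
qed

lemma C_inf_ex_biproduct:
  assumes X: "inf_complex C X" and Y: "inf_complex C Y"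
  shows "\<exists>B i j p q. biproduct (C_inf C) X Y B i j p q"
proof -
  note t = inf_complexD[OF X] inf_complexD[OF Y]
  have "\<exists>b i j p q. biproduct C (ob X n) (ob Y n) b i j p q" for n
    by (rule ex_biproduct) (simp_all add: t)
  then obtain b i j p q
    where bp: "biproduct C (ob X n) (ob Y n) (b n) (i n) (j n) (p n) (q n)" for n
    by metis
  then have b: "b n \<in> Obj C" "i n \<in> Hom C (ob X n) (b n)" "j n \<in> Hom C (ob Y n) (b n)"
    "p n \<in> Hom C (b n) (ob X n)" "q n \<in> Hom C (b n) (ob Y n)"
    "Comp C (ob X n) (b n) (ob X n) (p n) (i n) = Id C (ob X n)"
    "Comp C (ob Y n) (b n) (ob Y n) (q n) (j n) = Id C (ob Y n)"
    "Add C (b n) (b n) (Comp C (b n) (ob X n) (b n) (i n) (p n))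
      (Comp C (b n) (ob Y n) (b n) (j n) (q n)) = Id C (b n)" for n
    by (simp_all add: biproduct_def)
  have mixed: "Comp C (ob X n) (b n) (ob Y n) (q n) (i n) = Zero C (ob X n) (ob Y n)"
    "Comp C (ob Y n) (b n) (ob X n) (p n) (j n) = Zero C (ob Y n) (ob X n)" for n
    using biproduct_mixed_Zero[OF _ _ bp] t by simp_all
  \<comment> \<open>The diagonal differential \<open>i \<circ> d\<^sub>X \<circ> p + j \<circ> d\<^sub>Y \<circ> q\<close>.\<close>
  define d where "d n = Add C (b n) (b (n+1))
    (Comp C (b n) (ob X (n+1)) (b (n+1)) (i (n+1)) (Comp C (b n) (ob X n) (ob X (n+1)) (diff X n) (p n)))
    (Comp C (b n) (ob Y (n+1)) (b (n+1)) (j (n+1)) (Comp C (b n) (ob Y n) (ob Y (n+1)) (diff Y n) (q n)))"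
    for n
  have d: "d n \<in> Hom C (b n) (b (n+1))" for n
    by (simp add: d_def t b hom_simps)
  have di: "Comp C (ob X n) (b n) (b (n+1)) (d n) (i n) =
      Comp C (ob X n) (ob X (n+1)) (b (n+1)) (i (n+1)) (diff X n)" for n
    by (simp add: d_def t b mixed Comp_Add_left Comp_assoc hom_simps)
  have dj: "Comp C (ob Y n) (b n) (b (n+1)) (d n) (j n) =
      Comp C (ob Y n) (ob Y (n+1)) (b (n+1)) (j (n+1)) (diff Y n)" for n
    by (simp add: d_def t b mixed Comp_Add_left Comp_assoc hom_simps)
  have pd: "Comp C (b n) (b (n+1)) (ob X (n+1)) (p (n+1)) (d n) =
      Comp C (b n) (ob X n) (ob X (n+1)) (diff X n) (p n)" for n
    by (simp add: d_def t b mixed Comp_Add_right Comp_assoc[symmetric] hom_simps)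
  have qd: "Comp C (b n) (b (n+1)) (ob Y (n+1)) (q (n+1)) (d n) =
      Comp C (b n) (ob Y n) (ob Y (n+1)) (diff Y n) (q n)" for n
    by (simp add: d_def t b mixed Comp_Add_right Comp_assoc[symmetric] hom_simps)
  have "biproduct (C_inf C) X Y \<lparr>ob = b, diff = d\<rparr> i j p q"
    by (simp add: biproduct_def C_inf_simps inf_complex_def complex_morphism_def
        b d di dj pd qd)
  then show ?thesis
    by blast
qed

text \<open>
  A monomorphism is the kernel of its degreewise cokernel, because this holds in each degree.
\<close>

theorem abelian_C_inf: "abelian_category (C_inf C)"
proof -
  interpret K: preadditive_category "C_inf C"
    by (rule preadditive_C_inf)
  show ?thesis
  proof
    show "\<exists>Z. zero_object (C_inf C) Z"
      by (rule C_inf_ex_zero_object)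
  next
    fix X Y assume "X \<in> Obj (C_inf C)" "Y \<in> Obj (C_inf C)"
    then show "\<exists>B i j p q. biproduct (C_inf C) X Y B i j p q"
      using C_inf_ex_biproduct by (simp add: C_inf_simps)
  next
    fix X Y f assume "X \<in> Obj (C_inf C)" "Y \<in> Obj (C_inf C)" "f \<in> Hom (C_inf C) X Y"
    then have XY: "inf_complex C X" "inf_complex C Y" "complex_morphism C X Y f"
      by (simp_all add: C_inf_simps)
    show "\<exists>K m. is_kernel (C_inf C) X Y f K m"
      using ex_degreewise_kernel[OF XY] degreewise_kernel[OF XY(1,2) _ XY(3)] by metis
    show "\<exists>Q e. is_cokernel (C_inf C) X Y f Q e"
      using ex_degreewise_cokernel[OF XY] degreewise_cokernel[OF XY(1,2) _ XY(3)] by metis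
  next
    fix X Y m assume "X \<in> Obj (C_inf C)" "Y \<in> Obj (C_inf C)" and m: "monic (C_inf C) X Y m"
    then have XY: "inf_complex C X" "inf_complex C Y" "complex_morphism C X Y m"
      by (simp_all add: C_inf_simps monic_def)
    obtain Q e where Q: "inf_complex C Q" "complex_morphism C Y Q e"
      and coker: "\<And>n. is_cokernel C (ob X n) (ob Y n) (m n) (ob Q n) (e n)"
      using ex_degreewise_cokernel[OF XY] by blast
    have "is_kernel C (ob Y n) (ob Q n) (e n) (ob X n) (m n)" for n
      using monic_kernel_of_cokernel[OF _ _ degreewise_monic[OF XY(1,2) m] coker]
        inf_complexD(1)[OF XY(1)] inf_complexD(1)[OF XY(2)] by simp
    then have "is_kernel (C_inf C) Y Q e X m"
      by (rule degreewise_kernel[OF XY(2) Q(1) XY(1) Q(2) XY(3)])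
    then show "\<exists>Z \<in> Obj (C_inf C). \<exists>f \<in> Hom (C_inf C) Y Z. is_kernel (C_inf C) Y Z f X m"
      using Q by (auto simp: C_inf_simps)
  next
    fix X Y e assume "X \<in> Obj (C_inf C)" "Y \<in> Obj (C_inf C)" and e: "epic (C_inf C) X Y e"
    then have XY: "inf_complex C X" "inf_complex C Y" "complex_morphism C X Y e"
      by (simp_all add: C_inf_simps epic_def)
    obtain K m where K: "inf_complex C K" "complex_morphism C K X m"
      and ker: "\<And>n. is_kernel C (ob X n) (ob Y n) (e n) (ob K n) (m n)"
      using ex_degreewise_kernel[OF XY] by blast
    have "is_cokernel C (ob K n) (ob X n) (m n) (ob Y n) (e n)" for n
      using epic_cokernel_of_kernel[OF _ _ degreewise_epic[OF XY(1,2) e] ker]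
        inf_complexD(1)[OF XY(1)] inf_complexD(1)[OF XY(2)] by simp
    then have "is_cokernel (C_inf C) K X m Y e"
      by (rule degreewise_cokernel[OF K(1) XY(1,2) K(2) XY(3)])
    then show "\<exists>W \<in> Obj (C_inf C). \<exists>f \<in> Hom (C_inf C) W X. is_cokernel (C_inf C) W X f Y e"
      using K by (auto simp: C_inf_simps)
  qed
qed

end


section \<open>The condition \<open>d\<^sup>N = 0\<close>\<close>

context category
begin

lemma diff_pow_in_Hom:
  assumes "inf_complex C X"
  shows "diff_pow C X k n \<in> Hom C (ob X n) (ob X (n + int k))"
proof (induction k)
  case (Suc k)
  have "n + int (Suc k) = n + int k + 1"
    by simp
  then show ?case
    using Suc inf_complexD[OF assms] by (simp only: diff_pow.simps Comp_in_Hom)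
qed (use inf_complexD[OF assms] in \<open>simp add: Id_in_Hom\<close>)

text \<open>
  Pasting of commuting squares: a morphism of complexes commutes with \<open>d\<^sup>k\<close>.  This is what lets the
  condition \<open>d\<^sup>N = 0\<close> pass between complexes.
\<close>

lemma diff_pow_natural:
  assumes X: "inf_complex C X" and Y: "inf_complex C Y" and g: "complex_morphism C X Y g"
  shows "Comp C (ob X n) (ob X (n + int k)) (ob Y (n + int k)) (g (n + int k)) (diff_pow C X k n) =
    Comp C (ob X n) (ob Y n) (ob Y (n + int k)) (diff_pow C Y k n) (g n)"
proof (induction k)
  case (Suc k)
  let ?l = "n + int k"
  \<comment> \<open>The degree occurs in the objects, so the two forms of the index must be identified before the
    recursion equation of \<^const>\<open>diff_pow\<close> fits the goal.\<close>
  have l: "n + int (Suc k) = ?l + 1"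
    by simp
  note t = inf_complexD[OF X] inf_complexD[OF Y] complex_morphismD(1)[OF g]
    diff_pow_in_Hom[OF X] diff_pow_in_Hom[OF Y]
  have "Comp C (ob X n) (ob X (?l + 1)) (ob Y (?l + 1)) (g (?l + 1))
      (Comp C (ob X n) (ob X ?l) (ob X (?l + 1)) (diff X ?l) (diff_pow C X k n)) =
    Comp C (ob X n) (ob X ?l) (ob Y (?l + 1))
      (Comp C (ob X ?l) (ob X (?l + 1)) (ob Y (?l + 1)) (g (?l + 1)) (diff X ?l)) (diff_pow C X k n)"
    by (simp add: t Comp_assoc)
  also have "\<dots> = Comp C (ob X n) (ob Y ?l) (ob Y (?l + 1)) (diff Y ?l)
      (Comp C (ob X n) (ob X ?l) (ob Y ?l) (g ?l) (diff_pow C X k n))"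
    by (simp add: t Comp_assoc complex_morphismD(2)[OF g])
  also have "\<dots> = Comp C (ob X n) (ob Y n) (ob Y (?l + 1))
      (Comp C (ob Y n) (ob Y ?l) (ob Y (?l + 1)) (diff Y ?l) (diff_pow C Y k n)) (g n)"
    by (simp add: t Comp_assoc Suc.IH)
  finally show ?case
    by (simp only: l diff_pow.simps)
qed (use inf_complexD[OF X] inf_complexD[OF Y] complex_morphismD(1)[OF g] in
    \<open>simp add: Id_left Id_right\<close>)

end

definition N_nilpotent :: "('o, 'm, 'r) ab_cat_scheme \<Rightarrow> nat \<Rightarrow> ('o, 'm) diagram \<Rightarrow> bool" where
  "N_nilpotent A N X \<longleftrightarrow> (\<forall>n. diff_pow A X N n = Zero A (ob X n) (ob X (n + int N)))"

context preadditive_category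
begin

text \<open>
  \<open>m \<circ> d\<^sup>N = d\<^sup>N \<circ> m = 0 = m \<circ> 0\<close>, and \<open>m\<close> can be cancelled in degree \<open>n + N\<close>.
\<close>

lemma N_nilpotent_sub:
  assumes K: "inf_complex C K" and X: "inf_complex C X" and m: "complex_morphism C K X m"
    and mono: "\<And>n. monic C (ob K n) (ob X n) (m n)" and nil: "N_nilpotent C N X"
  shows "N_nilpotent C N K"
  unfolding N_nilpotent_def
proof
  fix n
  note t = inf_complexD[OF K] inf_complexD[OF X] complex_morphismD(1)[OF m] diff_pow_in_Hom[OF K]
  have "Comp C (ob K n) (ob K (n + int N)) (ob X (n + int N)) (m (n + int N)) (diff_pow C K N n) =
      Comp C (ob K n) (ob K (n + int N)) (ob X (n + int N)) (m (n + int N))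
        (Zero C (ob K n) (ob K (n + int N)))"
    using nil diff_pow_natural[OF K X m, of n N] t
    by (simp add: N_nilpotent_def Comp_Zero_left Comp_Zero_right)
  then show "diff_pow C K N n = Zero C (ob K n) (ob K (n + int N))"
    using mono[of "n + int N"] t Zero_in_Hom unfolding monic_def by blast
qed

text \<open>
  \<open>d\<^sup>N \<circ> e = e \<circ> d\<^sup>N = 0 = 0 \<circ> e\<close>, and \<open>e\<close> can be cancelled in degree \<open>n\<close>.
\<close>

lemma N_nilpotent_quotient:
  assumes X: "inf_complex C X" and Q: "inf_complex C Q" and e: "complex_morphism C X Q e"
    and epi: "\<And>n. epic C (ob X n) (ob Q n) (e n)" and nil: "N_nilpotent C N X"
  shows "N_nilpotent C N Q"
  unfolding N_nilpotent_def
proof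
  fix n
  note t = inf_complexD[OF Q] inf_complexD[OF X] complex_morphismD(1)[OF e] diff_pow_in_Hom[OF Q]
  have "Comp C (ob X n) (ob Q n) (ob Q (n + int N)) (diff_pow C Q N n) (e n) =
      Comp C (ob X n) (ob Q n) (ob Q (n + int N)) (Zero C (ob Q n) (ob Q (n + int N))) (e n)"
    using nil diff_pow_natural[OF X Q e, of n N] t
    by (simp add: N_nilpotent_def Comp_Zero_left Comp_Zero_right)
  then show "diff_pow C Q N n = Zero C (ob Q n) (ob Q (n + int N))"
    using epi[of n] t Zero_in_Hom unfolding epic_def by blast
qed

text \<open>
  \<open>d\<^sup>N = d\<^sup>N \<circ> (i \<circ> p + j \<circ> q) = i \<circ> d\<^sup>N \<circ> p + j \<circ> d\<^sup>N \<circ> q = 0\<close>, the inner powers being those of \<open>X\<close> and \<open>Y\<close>.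
\<close>

lemma N_nilpotent_biproduct:
  assumes X: "inf_complex C X" and Y: "inf_complex C Y"
    and nilX: "N_nilpotent C N X" and nilY: "N_nilpotent C N Y"
    and bp: "biproduct (C_inf C) X Y B i j p q"
  shows "N_nilpotent C N B"
  unfolding N_nilpotent_def
proof
  fix n
  have B: "inf_complex C B" and i: "complex_morphism C X B i" and j: "complex_morphism C Y B j"
    and p: "complex_morphism C B X p" and q: "complex_morphism C B Y q"
    and sum: "Add C (ob B n) (ob B n) (Comp C (ob B n) (ob X n) (ob B n) (i n) (p n))
      (Comp C (ob B n) (ob Y n) (ob B n) (j n) (q n)) = Id C (ob B n)"
    using bp by (auto simp: biproduct_def C_inf_simps dest: fun_cong)
  note t = inf_complexD[OF X] inf_complexD[OF Y] inf_complexD[OF B]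
    complex_morphismD(1)[OF i] complex_morphismD(1)[OF j] complex_morphismD(1)[OF p]
    complex_morphismD(1)[OF q] diff_pow_in_Hom[OF B]
  let ?D = "diff_pow C B N n" and ?l = "n + int N"
  have i0: "Comp C (ob X n) (ob B n) (ob B ?l) ?D (i n) = Zero C (ob X n) (ob B ?l)"
    using diff_pow_natural[OF X B i, of n N] nilX t by (simp add: N_nilpotent_def Comp_Zero_right)
  have j0: "Comp C (ob Y n) (ob B n) (ob B ?l) ?D (j n) = Zero C (ob Y n) (ob B ?l)"
    using diff_pow_natural[OF Y B j, of n N] nilY t by (simp add: N_nilpotent_def Comp_Zero_right)
  have "?D = Comp C (ob B n) (ob B n) (ob B ?l) ?D
      (Add C (ob B n) (ob B n) (Comp C (ob B n) (ob X n) (ob B n) (i n) (p n))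
        (Comp C (ob B n) (ob Y n) (ob B n) (j n) (q n)))"
    by (simp add: sum t Id_right)
  also have "\<dots> = Zero C (ob B n) (ob B ?l)"
    by (simp add: t Comp_Add_right Comp_assoc[symmetric] i0 j0 hom_simps)
  finally show "?D = Zero C (ob B n) (ob B ?l)" .
qed

text \<open>
  The identity of a zero object is zero in every degree, and every morphism factors through it.
  This covers \<open>N = 0\<close>, where \<open>d\<^sup>0\<close> is the identity itself.
\<close>

lemma N_nilpotent_zero_object:
  assumes "zero_object (C_inf C) Z"
  shows "N_nilpotent C N Z"
  unfolding N_nilpotent_def
proof
  fix n
  have Z: "inf_complex C Z"
    using assms by (simp add: zero_object_def C_inf_simps)
  have "(\<lambda>i. Id C (ob Z i)) = (\<lambda>i. Zero C (ob Z i) (ob Z i))"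
    using assms complex_morphism_Id[OF Z] complex_morphism_Zero[OF Z Z] Z
    unfolding zero_object_def C_inf_simps by blast
  then have Id: "Id C (ob Z n) = Zero C (ob Z n) (ob Z n)"
    by (rule fun_cong)
  show "diff_pow C Z N n = Zero C (ob Z n) (ob Z (n + int N))"
    using Id_right[of "ob Z n" "ob Z (n + int N)" "diff_pow C Z N n"]
      inf_complexD(1)[OF Z] diff_pow_in_Hom[OF Z] by (simp add: Id Comp_Zero_right)
qed

end

theorem proposition1p11:
  fixes A :: "('o, 'm) ab_cat" and N :: nat
  assumes "abelian_category A"
  shows "abelian_category (C_inf A) \<and> abelian_category (C_N A N)"
proof
  interpret abelian_category A
    by (rule assms)
  show "abelian_category (C_inf A)"
    by (rule abelian_C_inf)
  then interpret K: abelian_category "C_inf A" .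
  obtain Z where Z: "zero_object (C_inf A) Z"
    using K.ex_zero_object by blast
  have "abelian_category (full_subcategory (C_inf A) (N_nilpotent A N))"
  proof (rule K.abelian_full_subcategory[OF Z])
    show "N_nilpotent A N Z"
      using Z by (rule N_nilpotent_zero_object)
  next
    fix X Y B i j p q
    assume "X \<in> Obj (C_inf A)" "Y \<in> Obj (C_inf A)" "N_nilpotent A N X" "N_nilpotent A N Y"
      "biproduct (C_inf A) X Y B i j p q"
    then show "N_nilpotent A N B"
      unfolding C_inf_simps mem_Collect_eq by (rule N_nilpotent_biproduct)
  next
    fix X Y f K m
    assume *: "X \<in> Obj (C_inf A)" "Y \<in> Obj (C_inf A)" "f \<in> Hom (C_inf A) X Y"
      and nil: "N_nilpotent A N X" and ker: "is_kernel (C_inf A) X Y f K m"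
    have X: "inf_complex A X" and K: "inf_complex A K" and m: "complex_morphism A K X m"
      using * ker by (simp_all add: C_inf_simps is_kernel_def)
    have "monic (C_inf A) K X m"
      using ker * by (rule K.kernel_monic)
    then show "N_nilpotent A N K"
      by (intro N_nilpotent_sub[OF K X m _ nil] degreewise_monic[OF K X])
  next
    fix X Y f Q e
    assume *: "X \<in> Obj (C_inf A)" "Y \<in> Obj (C_inf A)" "f \<in> Hom (C_inf A) X Y"
      and nil: "N_nilpotent A N Y" and coker: "is_cokernel (C_inf A) X Y f Q e"
    have Y: "inf_complex A Y" and Q: "inf_complex A Q" and e: "complex_morphism A Y Q e"
      using * coker by (simp_all add: C_inf_simps is_cokernel_def)
    have "epic (C_inf A) Y Q e"
      using coker * by (rule K.cokernel_epic)
    then show "N_nilpotent A N Q"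
      by (intro N_nilpotent_quotient[OF Y Q e _ nil] degreewise_epic[OF Y Q])
  qed
  then show "abelian_category (C_N A N)"
    by (simp add: C_N_def N_nilpotent_def[abs_def])
qed

end
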